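(* Let $\mathcal{G}=((V,E),\lambda)$ be a temporal clique on $n$ nodes. Then $\mathcal{G}$ is a 1D-mobility temporal clique if and only if there exists an ordering of $V$ that excludes the four forbidden ordered temporal patterns, i.e. an ordering $v_1,\dots,v_n$ of $V$ such that for all indices $i<j<k$, the label $\lambda(v_iv_k)$ is the median of $\{\lambda(v_iv_j),\lambda(v_iv_k),\lambda(v_jv_k)\}$.
   Context: A temporal clique $\mathcal{G}=((V,E),\lambda)$ is a complete graph $(V,E)$ on $n$ nodes together with a labeling $\lambda:E\to\mathbb{N}$ giving each edge a single appearance time. The labels are pairwise distinct; up to order-preserving relabeling of times, the lifetime is $T=n(n-1)/2$ and exactly one edge appears at each time $t\in\{1,\dots,T\}$. Two temporal graphs are isomorphic if there is a bijection between their vertex sets mapping edges to edges with the same label. 1D-mobility model: $n$ agents (the nodes) lie on a line in an initial ordering $\pi$ (a sequence listing all agents). A 1D-mobility schedule from $\pi$ is a sequence $x=(x_1,\dots,x_T)$ of pairs of agents, where, setting $\pi_0=\pi$, each $x_t=\{u,v\}$ consists of two agents that are consecutive in $\pi_{t-1}$, and $\pi_t$ is obtained from $\pi_{t-1}$ by exchanging $u$ and $v$ (a crossing). The temporal graph $\mathcal{G}_{\pi,x}$ has vertex set the agents and an edge $uv$ with label $t$ whenever $x_t=uv$. A temporal clique is a 1D-mobility temporal clique if it is isomorphic to $\mathcal{G}_{\pi,x}$ for some ordering $\pi$ and some 1D-mobility schedule $x$ from $\pi$ such that $\mathcal{G}_{\pi,x}$ is a temporal clique (each pair of agents crosses exactly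 once). The four forbidden ordered patterns are the ordered triangles $a,b,c$ (ordered left to right) in which the edge $ac$ has the smallest label (two patterns, according to whether $\lambda(ab)<\lambda(bc)$ or not) or the largest label (two patterns); an ordering excludes them exactly when, for every three nodes appearing in the order $a,b,c$, $\lambda(ac)$ lies strictly between $\lambda(ab)$ and $\lambda(bc)$. *)

theory Defs
  imports Main "HOL-Library.Ramsey" "HOL-Combinatorics.Transposition"
begin

text \<open>
  A temporal graph is a vertex set together with a set of labelled edges \<open>(e, t)\<close>, meaning that
  edge \<open>e\<close> appears at time \<open>t\<close>. An edge may carry several labels: this is what an arbitrary
  mobility schedule produces when a pair crosses more than once.
\<close>

type_synonym 'a temporal_graph = "'a set \<times> ('a set \<times> nat) set"

definition temporal_clique :: "'a set \<Rightarrow> ('a set \<Rightarrow> nat) \<Rightarrow> bool" where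
  "temporal_clique V lam \<longleftrightarrow> finite V \<and> inj_on lam (nsets V 2)"

definition clique_graph :: "'a set \<Rightarrow> ('a set \<Rightarrow> nat) \<Rightarrow> 'a temporal_graph" where
  "clique_graph V lam = (V, {(e, lam e) | e. e \<in> nsets V 2})"

definition is_temporal_clique :: "'a temporal_graph \<Rightarrow> bool" where
  "is_temporal_clique G \<longleftrightarrow> (\<exists>V lam. temporal_clique V lam \<and> G = clique_graph V lam)"

definition isomorphic :: "'a temporal_graph \<Rightarrow> 'b temporal_graph \<Rightarrow> bool" where
  "isomorphic G H \<longleftrightarrow>
     (\<exists>f. bij_betw f (fst G) (fst H) \<and> snd H = {(f ` e, t) | e t. (e, t) \<in> snd G})"

definition consecutive :: "'a list \<Rightarrow> 'a \<Rightarrow> 'a \<Rightarrow> bool" where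
  "consecutive ps u v \<longleftrightarrow> (\<exists>i. Suc i < length ps \<and> ps ! i = u \<and> ps ! Suc i = v)"

fun mobility_schedule :: "'a list \<Rightarrow> 'a set list \<Rightarrow> bool" where
  "mobility_schedule ps [] \<longleftrightarrow> True"
| "mobility_schedule ps (e # xs) \<longleftrightarrow>
     (\<exists>u v. e = {u, v} \<and> consecutive ps u v \<and> mobility_schedule (map (transpose u v) ps) xs)"

text \<open>Times start at 1, list indices at 0.\<close>

definition mobility_graph :: "'a list \<Rightarrow> 'a set list \<Rightarrow> 'a temporal_graph" where
  "mobility_graph ps xs = (set ps, {(xs ! t, Suc t) | t. t < length xs})"

text \<open>
  The labels of a temporal clique are arbitrary distinct naturals, whereas those of a mobility
  clique on \<open>n\<close> agents are \<open>1, \<dots>, n (n - 1) / 2\<close>; hence the order-preserving relabelling \<open>r\<close> of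
  times, which is the identity on the labels if these are already \<open>1, \<dots>, n (n - 1) / 2\<close>.
  Taking the agents from the vertex type is no restriction, since \<open>V\<close> itself can serve as the
  set of agents.
\<close>

definition mobility_temporal_clique :: "'a set \<Rightarrow> ('a set \<Rightarrow> nat) \<Rightarrow> bool" where
  "mobility_temporal_clique V lam \<longleftrightarrow> temporal_clique V lam \<and>
     (\<exists>r (ps :: 'a list) xs.
        strict_mono_on (lam ` nsets V 2) r \<and>
        distinct ps \<and> mobility_schedule ps xs \<and>
        is_temporal_clique (mobility_graph ps xs) \<and>
        isomorphic (clique_graph V (r \<circ> lam)) (mobility_graph ps xs))"

definition ordering_of :: "'a set \<Rightarrow> 'a list \<Rightarrow> bool" where
  "ordering_of V vs \<longleftrightarrow> distinct vs \<and> set vs = V"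

text \<open>
  The four forbidden ordered triangles, in terms of the labels of \<open>ab\<close>, \<open>ac\<close>, \<open>bc\<close> for
  \<open>a\<close>, \<open>b\<close>, \<open>c\<close> ordered from left to right.
\<close>

definition forbidden_pattern :: "nat \<Rightarrow> nat \<Rightarrow> nat \<Rightarrow> bool" where
  "forbidden_pattern ab ac bc \<longleftrightarrow>
     ac < ab \<and> ab < bc \<or> ac < bc \<and> bc < ab \<or>
     ab < bc \<and> bc < ac \<or> bc < ab \<and> ab < ac"

definition excludes_forbidden_patterns :: "('a set \<Rightarrow> nat) \<Rightarrow> 'a list \<Rightarrow> bool" where
  "excludes_forbidden_patterns lam vs \<longleftrightarrow>
     (\<forall>i j k. i < j \<and> j < k \<and> k < length vs \<longrightarrow>
        \<not> forbidden_pattern (lam {vs ! i, vs ! j}) (lam {vs ! i, vs ! k}) (lam {vs ! j, vs ! k}))"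

definition is_median :: "nat \<Rightarrow> nat set \<Rightarrow> bool" where
  "is_median m S \<longleftrightarrow> m \<in> S \<and> card {s \<in> S. s < m} = card {s \<in> S. m < s}"

lemma is_median_3_iff:
  assumes "p \<noteq> q" "q \<noteq> r" "p \<noteq> r"
  shows "is_median q {p, q, r} \<longleftrightarrow> \<not> forbidden_pattern p q r"
proof -
  have 1: "{s \<in> {p, q, r}. s < q} = (if p < q then {p} else {}) \<union> (if r < q then {r} else {})"
    and 2: "{s \<in> {p, q, r}. q < s} = (if q < p then {p} else {}) \<union> (if q < r then {r} else {})"
    by auto
  show ?thesis
    unfolding is_median_def 1 2 forbidden_pattern_def using assms by auto
qed

lemma excludes_forbidden_patterns_iff_median:
  assumes "temporal_clique V lam" and "ordering_of V vs"
  shows "excludes_forbidden_patterns lam vs \<longleftrightarrow>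
    (\<forall>i j k. i < j \<and> j < k \<and> k < length vs \<longrightarrow>
       is_median (lam {vs ! i, vs ! k})
         {lam {vs ! i, vs ! j}, lam {vs ! i, vs ! k}, lam {vs ! j, vs ! k}})"
proof -
  have "is_median (lam {vs ! i, vs ! k})
          {lam {vs ! i, vs ! j}, lam {vs ! i, vs ! k}, lam {vs ! j, vs ! k}} \<longleftrightarrow>
        \<not> forbidden_pattern (lam {vs ! i, vs ! j}) (lam {vs ! i, vs ! k}) (lam {vs ! j, vs ! k})"
    if ijk: "i < j \<and> j < k \<and> k < length vs" for i j k
  proof (rule is_median_3_iff)
    have V: "vs ! i \<in> V" "vs ! j \<in> V" "vs ! k \<in> V"
      using assms(2) ijk by (auto simp: ordering_of_def)
    have ne: "vs ! i \<noteq> vs ! j" "vs ! j \<noteq> vs ! k" "vs ! i \<noteq> vs ! k"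
      using assms(2) ijk by (auto simp: ordering_of_def nth_eq_iff_index_eq)
    have E: "{vs ! i, vs ! j} \<in> nsets V 2" "{vs ! i, vs ! k} \<in> nsets V 2"
      "{vs ! j, vs ! k} \<in> nsets V 2"
      using V ne by (auto simp: nsets_def)
    have inj: "inj_on lam (nsets V 2)"
      using assms(1) by (simp add: temporal_clique_def)
    show "lam {vs ! i, vs ! j} \<noteq> lam {vs ! i, vs ! k}"
      "lam {vs ! i, vs ! k} \<noteq> lam {vs ! j, vs ! k}"
      "lam {vs ! i, vs ! j} \<noteq> lam {vs ! j, vs ! k}"
      using E ne by (auto simp: inj_on_eq_iff[OF inj] doubleton_eq_iff)
  qed
  then show ?thesis
    unfolding excludes_forbidden_patterns_def by blast
qed

end

theory Submission
  imports Defs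
begin

text \<open>
  Two agents can cross exactly when no third agent \<open>b\<close> is between them, i.e. every \<open>b\<close> is on the same
  side of both. The order of two agents at time \<open>t\<close> is their initial order, reversed if they crossed
  before \<open>t\<close>. So a sequence in which each pair crosses once is a schedule iff, for every crossing
  \<open>{a, c}\<close> and every third agent \<open>b\<close>, the initial orders corrected by the crossings \<open>{a, b}\<close> and
  \<open>{b, c}\<close> made so far agree. For \<open>x\<close>, \<open>y\<close>, \<open>z\<close> initially from left to right, this condition at each
  of the three crossings says the same thing: \<open>{x, z}\<close> is the second of the three to cross.
\<close>

section \<open>Left-to-right order of agents\<close>

text \<open>A strict linear order on the entries when the list is distinct. The recursion lets it be
  computed on a list split as \<open>as @ u # v # bs\<close>; \<open>before_iff_nth\<close> gives
  the index form.\<close>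

fun before :: "'a list \<Rightarrow> 'a \<Rightarrow> 'a \<Rightarrow> bool" where
  "before [] x y \<longleftrightarrow> False"
| "before (z # zs) x y \<longleftrightarrow> z = x \<and> y \<in> set zs \<or> before zs x y"

lemma before_in_set: "before ps x y \<Longrightarrow> x \<in> set ps \<and> y \<in> set ps"
  by (induction ps) auto

lemma before_append:
  "before (ps @ qs) x y \<longleftrightarrow> before ps x y \<or> before qs x y \<or> x \<in> set ps \<and> y \<in> set qs"
  by (induction ps) auto

lemma before_iff_nth:
  "before ps x y \<longleftrightarrow> (\<exists>i j. i < j \<and> j < length ps \<and> ps ! i = x \<and> ps ! j = y)"
proof (induction ps)
  case Nil
  then show ?case by simp
next
  case (Cons z zs)
  show ?case
  proof
    assume "before (z # zs) x y"
    then consider "z = x" "y \<in> set zs" | "before zs x y" by auto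
    then show "\<exists>i j. i < j \<and> j < length (z # zs) \<and> (z # zs) ! i = x \<and> (z # zs) ! j = y"
    proof cases
      case 1
      then obtain k where "k < length zs" "zs ! k = y" by (auto simp: in_set_conv_nth)
      with 1 show ?thesis by (intro exI[of _ 0] exI[of _ "Suc k"]) auto
    next
      case 2
      then obtain i j where "i < j" "j < length zs" "zs ! i = x" "zs ! j = y"
        using Cons.IH by blast
      then show ?thesis by (intro exI[of _ "Suc i"] exI[of _ "Suc j"]) auto
    qed
  next
    assume "\<exists>i j. i < j \<and> j < length (z # zs) \<and> (z # zs) ! i = x \<and> (z # zs) ! j = y"
    then obtain i j where ij: "i < j" "j < length (z # zs)" "(z # zs) ! i = x" "(z # zs) ! j = y"
      by blast
    then obtain j' where j': "j = Suc j'" by (cases j) auto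
    show "before (z # zs) x y"
    proof (cases i)
      case 0
      then show ?thesis using ij j' by auto
    next
      case (Suc i')
      then show ?thesis using ij j' Cons.IH by auto
    qed
  qed
qed

lemma before_nth_iff:
  assumes "distinct ps" "i < length ps" "j < length ps"
  shows "before ps (ps ! i) (ps ! j) \<longleftrightarrow> i < j"
  using assms by (auto simp: before_iff_nth nth_eq_iff_index_eq)

lemma before_linear:
  assumes "distinct ps" "x \<in> set ps" "y \<in> set ps" "x \<noteq> y"
  shows "before ps y x \<longleftrightarrow> \<not> before ps x y"
  using assms by (auto simp: in_set_conv_nth before_nth_iff) (metis linorder_neqE_nat)

lemma before_trans:
  assumes "distinct ps" "before ps x y" "before ps y z"
  shows "before ps x z"
proof -
  obtain i j k where "i < length ps" "j < length ps" "k < length ps"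
      "ps ! i = x" "ps ! j = y" "ps ! k = z"
    using assms(2,3) before_in_set[of ps] by (metis in_set_conv_nth)
  then show ?thesis using assms by (auto simp: before_nth_iff)
qed

section \<open>Crossings of neighbours\<close>

lemma consecutive_append:
  "consecutive ps u v \<longleftrightarrow> (\<exists>as bs. ps = as @ u # v # bs)"
proof
  assume "consecutive ps u v"
  then obtain i where i: "Suc i < length ps" "ps ! i = u" "ps ! Suc i = v"
    by (auto simp: consecutive_def)
  then have "ps = take i ps @ u # v # drop (Suc (Suc i)) ps"
    by (metis Cons_nth_drop_Suc Suc_lessD append_take_drop_id)
  then show "\<exists>as bs. ps = as @ u # v # bs" by blast
next
  assume "\<exists>as bs. ps = as @ u # v # bs"
  then obtain as bs where "ps = as @ u # v # bs" by blast
  then show "consecutive ps u v"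
    by (auto simp: consecutive_def nth_append intro!: exI[of _ "length as"])
qed

lemma map_transpose_notin: "u \<notin> set ps \<Longrightarrow> v \<notin> set ps \<Longrightarrow> map (transpose u v) ps = ps"
  by (rule map_idI) (metis transpose_apply_other)

text \<open>The crossing turns \<open>as @ u # v # bs\<close> into \<open>as @ v # u # bs\<close>.
  Agents other than \<open>u\<close> and \<open>v\<close> do not move, and each stays on its side of
  both, so only the crossing pair is reversed. Here and below, \<open>\<noteq>\<close> between truth
  values is exclusive or.\<close>

lemma before_crossing:
  assumes "distinct ps" "consecutive ps u v" "x \<in> set ps" "y \<in> set ps" "x \<noteq> y"
  shows "before (map (transpose u v) ps) x y \<longleftrightarrow> before ps x y \<noteq> ({x, y} = {u, v})"
proof -
  obtain as bs where ps: "ps = as @ u # v # bs"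
    using assms(2) by (auto simp: consecutive_append)
  with assms(1) have "map (transpose u v) ps = as @ v # u # bs"
    by (simp add: map_transpose_notin)
  moreover have "before (as @ v # u # bs) x y \<longleftrightarrow> before ps x y \<noteq> ({x, y} = {u, v})"
    using assms ps before_in_set[of as x y] before_in_set[of bs x y]
    by (auto simp: before_append doubleton_eq_iff)
  ultimately show ?thesis by simp
qed

text \<open>No third agent fits between neighbours. Conversely, if \<open>c\<close> stood two or
  more places to the right of \<open>a\<close>, the right neighbour of \<open>a\<close> would
  separate them. The left side is a disjunction because \<open>consecutive\<close> is directed,
  whereas the condition is symmetric in \<open>a\<close> and \<open>c\<close>.\<close>

lemma consecutive_iff_before:
  assumes "distinct ps" "a \<in> set ps" "c \<in> set ps" "a \<noteq> c"
  shows "consecutive ps a c \<or> consecutive ps c a \<longleftrightarrow>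
    (\<forall>b \<in> set ps - {a, c}. before ps a b \<longleftrightarrow> before ps c b)" (is "?L \<longleftrightarrow> ?R")
proof
  have aux: "before ps a b \<longleftrightarrow> before ps c b"
    if ac: "consecutive ps a c" and b: "b \<in> set ps" "b \<noteq> a" "b \<noteq> c" for a b c
  proof -
    obtain as bs where "ps = as @ a # c # bs"
      using ac by (auto simp: consecutive_append)
    with b assms(1) show ?thesis
      using before_in_set[of as _ b] before_in_set[of bs _ b] by (auto simp: before_append)
  qed
  show ?R if ?L
    using that aux by blast
  have aux: "consecutive ps a c"
    if h: "\<forall>b \<in> set ps - {a, c}. before ps a b \<longleftrightarrow> before ps c b" and ac: "before ps a c" for a c
  proof -
    obtain i j where ij: "i < j" "j < length ps" "ps ! i = a" "ps ! j = c"
      using ac by (auto simp: before_iff_nth)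
    have "j = Suc i"
    proof (rule ccontr)
      assume "j \<noteq> Suc i"
      with ij have i: "Suc i < j" by simp
      then have "ps ! Suc i \<in> set ps - {a, c}"
        using ij assms(1) by (auto simp: nth_eq_iff_index_eq)
      then show False
        using h ij i assms(1) before_nth_iff[of ps i "Suc i"] before_nth_iff[of ps j "Suc i"] by auto
    qed
    then show ?thesis using ij by (auto simp: consecutive_def)
  qed
  show ?L if ?R
  proof (cases "before ps a c")
    case True
    then show ?thesis using aux[of a c] that by blast
  next
    case False
    then have "before ps c a" using before_linear[OF assms] by simp
    then show ?thesis using aux[of c a] that by (simp add: insert_commute)
  qed
qed

section \<open>Schedules in terms of the initial ordering\<close>

text \<open>\<open>as\<close> is the past of the crossing \<open>{a, c}\<close>, and each side of
  the equation is the order of a pair at that moment. Only the initial ordering occurs, so the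
  intermediate ones need not be followed.\<close>

definition same_sides :: "'a list \<Rightarrow> 'a set list \<Rightarrow> bool" where
  "same_sides ps xs \<longleftrightarrow> (\<forall>as bs a b c. xs = as @ {a, c} # bs \<longrightarrow> a \<noteq> c \<longrightarrow> b \<in> set ps - {a, c} \<longrightarrow>
     (before ps a b \<noteq> ({a, b} \<in> set as)) = (before ps c b \<noteq> ({c, b} \<in> set as)))"

text \<open>At later positions, exchanging \<open>u\<close> and \<open>v\<close> in the ordering has
  the same effect as counting \<open>e\<close> among the past crossings. What remains is the
  condition at \<open>e\<close> itself, with empty past, and it holds because \<open>u\<close> and
  \<open>v\<close> are consecutive.\<close>

lemma same_sides_Cons:
  assumes "distinct ps" "distinct (e # xs)" "set (e # xs) \<subseteq> nsets (set ps) 2"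
    and e: "e = {u, v}" "consecutive ps u v"
  shows "same_sides ps (e # xs) \<longleftrightarrow> same_sides (map (transpose u v) ps) xs"
proof -
  have uv: "u \<in> set ps" "v \<in> set ps" "u \<noteq> v"
    using assms(3) e by (auto simp: nsets_def card_insert_if split: if_splits)
  have set': "set (map (transpose u v) ps) = set ps"
    using uv by (auto simp: transpose_def)
  \<comment> \<open>For \<open>{x, b} = e\<close> the reversal sits in the list on the left and in
    the past on the right; distinctness keeps \<open>e\<close> out of \<open>as\<close>, so it is
    counted once on each side.\<close>
  have step: "(before (map (transpose u v) ps) x b \<noteq> ({x, b} \<in> set as)) \<longleftrightarrow>
      (before ps x b \<noteq> ({x, b} \<in> set (e # as)))"
    if "xs = as @ bs" "x \<in> set ps" "b \<in> set ps" "x \<noteq> b" for as bs x b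
    using before_crossing[OF assms(1) e(2) that(2-4)] that(1) assms(2) e(1) by auto
  have mem: "a \<in> set ps \<and> c \<in> set ps" if "xs = as @ {a, c} # bs" for as bs a c
    using assms(3) that by (auto simp: nsets_def)
  show ?thesis
  proof
    assume h: "same_sides ps (e # xs)"
    show "same_sides (map (transpose u v) ps) xs"
      unfolding same_sides_def set'
    proof (intro allI impI)
      fix as bs a b c
      assume a: "xs = as @ {a, c} # bs" "a \<noteq> c" "b \<in> set ps - {a, c}"
      have "(before ps a b \<noteq> ({a, b} \<in> set (e # as))) = (before ps c b \<noteq> ({c, b} \<in> set (e # as)))"
        using h a unfolding same_sides_def by (metis append_Cons)
      then show "(before (map (transpose u v) ps) a b \<noteq> ({a, b} \<in> set as)) =
          (before (map (transpose u v) ps) c b \<noteq> ({c, b} \<in> set as))"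
        using step[OF a(1), of a b] step[OF a(1), of c b] mem[OF a(1)] a(3) by auto
    qed
  next
    assume h: "same_sides (map (transpose u v) ps) xs"
    show "same_sides ps (e # xs)"
      unfolding same_sides_def
    proof (intro allI impI)
      fix as bs a b c
      assume a: "e # xs = as @ {a, c} # bs" "a \<noteq> c" "b \<in> set ps - {a, c}"
      show "(before ps a b \<noteq> ({a, b} \<in> set as)) = (before ps c b \<noteq> ({c, b} \<in> set as))"
      proof (cases as)
        case Nil
        with a(1) e(1) have ac: "{a, c} = {u, v}" by simp
        then have "a \<in> set ps" "c \<in> set ps" using uv by auto
        moreover have "consecutive ps a c \<or> consecutive ps c a"
          using ac e(2) by (auto simp: doubleton_eq_iff)
        ultimately show ?thesis
          using consecutive_iff_before[OF assms(1), of a c] a(2,3) Nil by simp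
      next
        case (Cons d ds)
        with a(1) have x: "xs = ds @ {a, c} # bs" "as = e # ds" by auto
        then have "(before (map (transpose u v) ps) a b \<noteq> ({a, b} \<in> set ds)) =
            (before (map (transpose u v) ps) c b \<noteq> ({c, b} \<in> set ds))"
          using h a(2,3) unfolding same_sides_def set' by blast
        then show ?thesis
          using step[OF x(1), of a b] step[OF x(1), of c b] mem[OF x(1)] a(3) x(2) by auto
      qed
    qed
  qed
qed

text \<open>The rest of a schedule starts from the exchanged ordering, hence the induction for
  arbitrary \<open>ps\<close>; \<open>same_sides_Cons\<close> carries the condition over to that
  ordering.\<close>

lemma mobility_schedule_iff_same_sides:
  assumes "distinct ps" "distinct xs" "set xs \<subseteq> nsets (set ps) 2"
  shows "mobility_schedule ps xs \<longleftrightarrow> same_sides ps xs"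
  using assms
proof (induction xs arbitrary: ps)
  case Nil
  then show ?case by (simp add: same_sides_def)
next
  case (Cons e xs)
  have rec: "mobility_schedule (map (transpose u v) ps) xs \<longleftrightarrow> same_sides ps (e # xs)"
    if uv: "e = {u, v}" "consecutive ps u v" for u v
  proof -
    have "u \<in> set ps" "v \<in> set ps" using uv Cons.prems(3) by (auto simp: nsets_def)
    then have "set (map (transpose u v) ps) = set ps" by (auto simp: transpose_def)
    moreover have "distinct (map (transpose u v) ps)"
      using Cons.prems(1) by (simp add: distinct_map)
    ultimately show ?thesis
      using Cons.IH[of "map (transpose u v) ps"] Cons.prems same_sides_Cons[OF Cons.prems uv] by auto
  qed
  \<comment> \<open>For the first entry the past is empty, so the condition says that no third agent
    separates its two agents, which makes them neighbours.\<close>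
  have "\<exists>u v. e = {u, v} \<and> consecutive ps u v" if "same_sides ps (e # xs)"
  proof -
    have "e \<in> nsets (set ps) 2" using Cons.prems(3) by simp
    then obtain a c where ac: "e = {a, c}" "a \<noteq> c" "a \<in> set ps" "c \<in> set ps"
      by (auto simp: nsets_def card_2_iff)
    have "\<forall>b \<in> set ps - {a, c}. before ps a b \<longleftrightarrow> before ps c b"
    proof
      fix b assume "b \<in> set ps - {a, c}"
      moreover have "e # xs = [] @ {a, c} # xs" using ac(1) by simp
      ultimately have "(before ps a b \<noteq> ({a, b} \<in> set [])) = (before ps c b \<noteq> ({c, b} \<in> set []))"
        using that ac(2) unfolding same_sides_def by blast
      then show "before ps a b \<longleftrightarrow> before ps c b" by simp
    qed
    then have "consecutive ps a c \<or> consecutive ps c a"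
      using consecutive_iff_before[OF Cons.prems(1) ac(3,4,2)] by simp
    then show ?thesis using ac(1) by (metis insert_commute)
  qed
  then show ?case using rec by auto
qed

section \<open>From past crossings to labels and patterns\<close>

lemma excludes_forbidden_patterns_iff_before:
  assumes "distinct ps"
  shows "excludes_forbidden_patterns mu ps \<longleftrightarrow>
    (\<forall>x y z. before ps x y \<and> before ps y z \<longrightarrow>
       \<not> forbidden_pattern (mu {x, y}) (mu {x, z}) (mu {y, z}))" (is "_ \<longleftrightarrow> ?R")
proof
  assume h: "excludes_forbidden_patterns mu ps"
  show ?R
  proof (intro allI impI)
    fix x y z assume xyz: "before ps x y \<and> before ps y z"
    then obtain i j k where "i < length ps" "j < length ps" "k < length ps"
        "ps ! i = x" "ps ! j = y" "ps ! k = z"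
      using before_in_set[of ps] by (metis in_set_conv_nth)
    then show "\<not> forbidden_pattern (mu {x, y}) (mu {x, z}) (mu {y, z})"
      using h xyz assms before_nth_iff[OF assms] unfolding excludes_forbidden_patterns_def by blast
  qed
next
  assume h: ?R
  show "excludes_forbidden_patterns mu ps"
    unfolding excludes_forbidden_patterns_def
  proof (intro allI impI)
    fix i j k assume "i < j \<and> j < k \<and> k < length ps"
    then show "\<not> forbidden_pattern (mu {ps ! i, ps ! j}) (mu {ps ! i, ps ! k}) (mu {ps ! j, ps ! k})"
      using h before_nth_iff[OF assms] by simp
  qed
qed

text \<open>Along a list sorted by \<open>mu\<close>, the past of an edge consists of the edges with
  smaller label. As every pair occurs in \<open>xs\<close>, splittings of \<open>xs\<close> can be
  replaced by triples of agents.\<close>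

lemma same_sides_iff_labels:
  fixes mu :: "'a set \<Rightarrow> 'b :: linorder"
  assumes "sorted_wrt (\<lambda>d e. mu d < mu e) xs" "set xs = nsets (set ps) 2"
  shows "same_sides ps xs \<longleftrightarrow>
    (\<forall>a b c. {a, b, c} \<subseteq> set ps \<longrightarrow> distinct [a, b, c] \<longrightarrow>
       (before ps a b \<noteq> (mu {a, b} < mu {a, c})) = (before ps c b \<noteq> (mu {b, c} < mu {a, c})))"
    (is "_ \<longleftrightarrow> ?R")
proof -
  have pre: "d \<in> set as \<longleftrightarrow> mu d < mu e" if "xs = as @ e # bs" "d \<in> set xs" for as bs d e
    using assms(1) that by (auto simp: sorted_wrt_append)
  have edge: "{x, y} \<in> set xs" if "x \<in> set ps" "y \<in> set ps" "x \<noteq> y" for x y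
    using that by (auto simp: assms(2) nsets_def)
  show ?thesis
  proof
    assume h: "same_sides ps xs"
    show ?R
    proof (intro allI impI)
      fix a b c assume abc: "{a, b, c} \<subseteq> set ps" "distinct [a, b, c]"
      then obtain as bs where x: "xs = as @ {a, c} # bs"
        using edge[of a c] by (auto dest: split_list)
      then have "(before ps a b \<noteq> ({a, b} \<in> set as)) = (before ps c b \<noteq> ({c, b} \<in> set as))"
        using h[unfolded same_sides_def, rule_format, OF x, of b] abc by force
      then show "(before ps a b \<noteq> (mu {a, b} < mu {a, c})) =
          (before ps c b \<noteq> (mu {b, c} < mu {a, c}))"
        using pre[OF x] edge[of a b] edge[of b c] abc by (auto simp: insert_commute)
    qed
  next
    assume h: ?R
    show "same_sides ps xs"
      unfolding same_sides_def
    proof (intro allI impI)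
      fix as bs a b c assume x: "xs = as @ {a, c} # bs" and abc: "a \<noteq> c" "b \<in> set ps - {a, c}"
      have "{a, c} \<in> nsets (set ps) 2" using x assms(2) by (metis in_set_conv_decomp)
      then have ac: "a \<in> set ps" "c \<in> set ps" by (auto simp: nsets_def)
      then have "(before ps a b \<noteq> (mu {a, b} < mu {a, c})) =
          (before ps c b \<noteq> (mu {b, c} < mu {a, c}))"
        using h abc by auto
      then show "(before ps a b \<noteq> ({a, b} \<in> set as)) = (before ps c b \<noteq> ({c, b} \<in> set as))"
        using pre[OF x] edge[of a b] edge[of b c] abc ac by (auto simp: insert_commute)
    qed
  qed
qed

lemma mobility_schedule_iff_excludes_forbidden_patterns:
  assumes "distinct ps" and sorted: "sorted_wrt (\<lambda>d e. mu d < mu e) xs"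
    and xs: "set xs = nsets (set ps) 2"
  shows "mobility_schedule ps xs \<longleftrightarrow> excludes_forbidden_patterns mu ps"
proof -
  have inj: "mu d \<noteq> mu e" if "d \<in> set xs" "e \<in> set xs" "d \<noteq> e" for d e
    using sorted that by (induction xs) auto
  have "distinct xs"
    using sorted by (induction xs) auto
  then have "mobility_schedule ps xs \<longleftrightarrow> same_sides ps xs"
    using mobility_schedule_iff_same_sides assms by blast
  also have "\<dots> \<longleftrightarrow> excludes_forbidden_patterns mu ps"
    unfolding same_sides_iff_labels[OF sorted xs] excludes_forbidden_patterns_iff_before[OF assms(1)]
  proof (rule iffI; intro allI impI)
    fix x y z
    assume h: "\<forall>a b c. {a, b, c} \<subseteq> set ps \<longrightarrow> distinct [a, b, c] \<longrightarrow>
       (before ps a b \<noteq> (mu {a, b} < mu {a, c})) = (before ps c b \<noteq> (mu {b, c} < mu {a, c}))"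
      and xyz: "before ps x y \<and> before ps y z"
    have "distinct [x, y, z]"
      using xyz before_trans[OF assms(1)] assms(1)
      by (auto simp: before_iff_nth nth_eq_iff_index_eq)
    moreover have "{x, y, z} \<subseteq> set ps" using xyz before_in_set[of ps] by blast
    \<comment> \<open>\<open>x\<close> and \<open>z\<close> start on opposite sides of
      \<open>y\<close>, so the condition at \<open>{x, z}\<close> says that exactly one of
      \<open>{x, y}\<close>, \<open>{y, z}\<close> has a smaller label. This rules out a smallest or
      largest label on \<open>{x, z}\<close>.\<close>
    ultimately have "(mu {x, y} < mu {x, z}) \<noteq> (mu {y, z} < mu {x, z})"
      using h xyz before_linear[OF assms(1), of y z] by auto
    then show "\<not> forbidden_pattern (mu {x, y}) (mu {x, z}) (mu {y, z})"
      by (auto simp: forbidden_pattern_def)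
  next
    fix a b c
    assume h: "\<forall>x y z. before ps x y \<and> before ps y z \<longrightarrow>
        \<not> forbidden_pattern (mu {x, y}) (mu {x, z}) (mu {y, z})"
      and abc: "{a, b, c} \<subseteq> set ps" "distinct [a, b, c]"
    \<comment> \<open>The patterns are strict comparisons, so ties would escape them.\<close>
    have ne: "mu {a, b} \<noteq> mu {a, c}" "mu {a, b} \<noteq> mu {b, c}" "mu {a, c} \<noteq> mu {b, c}"
      using abc inj[of "{a, b}" "{a, c}"] inj[of "{a, b}" "{b, c}"] inj[of "{a, c}" "{b, c}"]
      by (auto simp: xs nsets_def doubleton_eq_iff)
    have lin: "before ps b a \<longleftrightarrow> \<not> before ps a b" "before ps c a \<longleftrightarrow> \<not> before ps a c"
        "before ps c b \<longleftrightarrow> \<not> before ps b c"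
      using before_linear[OF assms(1)] abc by auto
    have sym: "{b, a} = {a, b}" "{c, a} = {a, c}" "{c, b} = {b, c}" by auto
    have trans: "before ps a b \<and> before ps b c \<longrightarrow> before ps a c"
        "\<not> before ps a b \<and> \<not> before ps b c \<longrightarrow> \<not> before ps a c"
      using before_trans[OF assms(1)] lin by blast+
    note h' = h[rule_format, unfolded forbidden_pattern_def]
    \<comment> \<open>The six orders of \<open>a\<close>, \<open>b\<close>, \<open>c\<close>. If
      \<open>b\<close> is in the middle, the label of \<open>{a, c}\<close> is the median, as
      required for agents on opposite sides of \<open>b\<close>. If \<open>b\<close> is at an end,
      the median belongs to another pair, so the labels of \<open>{a, b}\<close> and
      \<open>{b, c}\<close> are both below or both above that of \<open>{a, c}\<close>.\<close>
    consider "before ps a b" "before ps b c" | "before ps a c" "before ps c b"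
      | "before ps b a" "before ps a c" | "before ps b c" "before ps c a"
      | "before ps c a" "before ps a b" | "before ps c b" "before ps b a"
      using lin by blast
    then show "(before ps a b \<noteq> (mu {a, b} < mu {a, c})) =
        (before ps c b \<noteq> (mu {b, c} < mu {a, c}))"
    proof cases
      case 1
      then show ?thesis using h'[of a b c] lin ne unfolding sym by auto
    next
      case 2
      then show ?thesis using h'[of a c b] lin trans ne unfolding sym by auto
    next
      case 3
      then show ?thesis using h'[of b a c] lin trans ne unfolding sym by auto
    next
      case 4
      then show ?thesis using h'[of b c a] lin trans ne unfolding sym by auto
    next
      case 5
      then show ?thesis using h'[of c a b] lin trans ne unfolding sym by auto
    next
      case 6
      then show ?thesis using h'[of c b a] lin trans ne unfolding sym by auto
    qed
  qed
  finally show ?thesis .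
qed

section \<open>Passing between given labels and crossing times\<close>

lemma forbidden_pattern_strict_mono_on:
  assumes "strict_mono_on A r" "p \<in> A" "q \<in> A" "s \<in> A"
  shows "forbidden_pattern (r p) (r q) (r s) \<longleftrightarrow> forbidden_pattern p q s"
  using assms unfolding forbidden_pattern_def by (simp add: strict_mono_on_less)

theorem mainTheorem1:
  fixes V :: "'a set" and lam :: "'a set \<Rightarrow> nat"
  assumes "temporal_clique V lam"
  shows "mobility_temporal_clique V lam \<longleftrightarrow>
    (\<exists>vs. ordering_of V vs \<and> excludes_forbidden_patterns lam vs)"
proof
  assume "mobility_temporal_clique V lam"
  then obtain r and ps :: "'a list" and xs where
    r: "strict_mono_on (lam ` nsets V 2) r" and ps: "distinct ps" "mobility_schedule ps xs"
    and tc: "is_temporal_clique (mobility_graph ps xs)"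
    and iso: "isomorphic (clique_graph V (r \<circ> lam)) (mobility_graph ps xs)"
    unfolding mobility_temporal_clique_def by blast
  obtain W mu where "mobility_graph ps xs = clique_graph W mu"
    using tc by (auto simp: is_temporal_clique_def)
  then have W: "W = set ps"
    and E: "{(xs ! t, Suc t) |t. t < length xs} = {(e, mu e) |e. e \<in> nsets (set ps) 2}"
    by (auto simp: mobility_graph_def clique_graph_def)
  \<comment> \<open>Comparing the two descriptions of the edge set shows that \<open>mu\<close> is
    the crossing time and that \<open>xs\<close> runs through all pairs by increasing
    \<open>mu\<close>.\<close>
  have edge: "xs ! t \<in> nsets (set ps) 2 \<and> mu (xs ! t) = Suc t" if "t < length xs" for t
  proof -
    have "(xs ! t, Suc t) \<in> {(e, mu e) |e. e \<in> nsets (set ps) 2}" using that E by blast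
    then show ?thesis by auto
  qed
  have "e \<in> set xs" if "e \<in> nsets (set ps) 2" for e
  proof -
    have "(e, mu e) \<in> {(xs ! t, Suc t) |t. t < length xs}" using that E by blast
    then show ?thesis by auto
  qed
  then have xs: "set xs = nsets (set ps) 2"
    using edge by (auto simp: in_set_conv_nth)
  have "sorted_wrt (\<lambda>d e. mu d < mu e) xs"
    using edge by (auto simp: sorted_wrt_iff_nth_less)
  then have ex: "excludes_forbidden_patterns mu ps"
    using mobility_schedule_iff_excludes_forbidden_patterns ps xs by blast
  obtain f where f: "bij_betw f V (set ps)"
    and F: "{(xs ! t, Suc t) |t. t < length xs} =
      {(f ` e, t) |e t. (e, t) \<in> {(e, (r \<circ> lam) e) |e. e \<in> nsets V 2}}"
    using iso by (auto simp: isomorphic_def mobility_graph_def clique_graph_def)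
  have mu: "mu (f ` e) = r (lam e)" if "e \<in> nsets V 2" for e
  proof -
    have "(f ` e, r (lam e)) \<in> {(xs ! t, Suc t) |t. t < length xs}"
      unfolding F using that by auto
    then show ?thesis using edge by auto
  qed
  \<comment> \<open>The initial ordering pulled back along the isomorphism \<open>f\<close>. A
    pattern of \<open>lam\<close> in \<open>vs\<close> is one of \<open>r \<circ> lam\<close>, as
    \<open>r\<close> is strictly increasing, and hence one of \<open>mu\<close> in
    \<open>ps\<close>.\<close>
  define vs where "vs = map (inv_into V f) ps"
  have g: "bij_betw (inv_into V f) (set ps) V" using f by (rule bij_betw_inv_into)
  have vs: "distinct vs" "set vs = V"
    using g ps(1) by (auto simp: vs_def distinct_map bij_betw_def)
  have fvs: "f (vs ! i) = ps ! i" if "i < length ps" for i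
    using that f by (simp add: vs_def bij_betw_inv_into_right)
  have "\<not> forbidden_pattern (lam {vs ! i, vs ! j}) (lam {vs ! i, vs ! k}) (lam {vs ! j, vs ! k})"
    if ijk: "i < j" "j < k" "k < length vs" for i j k
  proof -
    have len: "length vs = length ps" by (simp add: vs_def)
    have e: "{vs ! i, vs ! j} \<in> nsets V 2" "{vs ! i, vs ! k} \<in> nsets V 2"
        "{vs ! j, vs ! k} \<in> nsets V 2"
      using ijk vs by (auto simp: nsets_def nth_eq_iff_index_eq)
    have "\<not> forbidden_pattern (mu {ps ! i, ps ! j}) (mu {ps ! i, ps ! k}) (mu {ps ! j, ps ! k})"
      using ex ijk len unfolding excludes_forbidden_patterns_def by simp
    then have "\<not> forbidden_pattern (r (lam {vs ! i, vs ! j})) (r (lam {vs ! i, vs ! k}))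
        (r (lam {vs ! j, vs ! k}))"
      using mu[OF e(1)] mu[OF e(2)] mu[OF e(3)] fvs ijk len by simp
    then show ?thesis
      using forbidden_pattern_strict_mono_on[OF r] e by blast
  qed
  then have "excludes_forbidden_patterns lam vs"
    by (simp add: excludes_forbidden_patterns_def)
  then show "\<exists>vs. ordering_of V vs \<and> excludes_forbidden_patterns lam vs"
    using vs by (auto simp: ordering_of_def)
next
  assume "\<exists>vs. ordering_of V vs \<and> excludes_forbidden_patterns lam vs"
  then obtain vs where vs: "distinct vs" "set vs = V" and ex: "excludes_forbidden_patterns lam vs"
    by (auto simp: ordering_of_def)
  define E where "E = nsets V 2"
  have fin: "finite E" and inj: "inj_on lam E"
    using assms by (auto simp: temporal_clique_def E_def finite_imp_finite_nsets)
  \<comment> \<open>The agents are the vertices themselves, and the pairs cross by increasing label: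
    \<open>L\<close> lists the labels in order, \<open>xs\<close> the edges carrying them.\<close>
  define L where "L = sorted_list_of_set (lam ` E)"
  have L: "sorted_wrt (<) L" "set L = lam ` E"
    using fin by (auto simp: L_def)
  define xs where "xs = map (inv_into E lam) L"
  have lam_xs: "lam (xs ! t) = L ! t" if "t < length L" for t
    using that L(2) nth_mem[OF that] by (simp add: xs_def f_inv_into_f)
  have xs: "set xs = E"
    using inj L(2) by (simp add: xs_def inv_into_image_cancel)
  have "sorted_wrt (\<lambda>d e. lam d < lam e) xs"
    using L(1) lam_xs by (auto simp: sorted_wrt_iff_nth_less xs_def)
  then have sched: "mobility_schedule vs xs"
    using mobility_schedule_iff_excludes_forbidden_patterns[OF vs(1)] xs vs(2) ex
    by (simp add: E_def)
  \<comment> \<open>The rank of a label in \<open>L\<close>, counted from 1 as crossing times are.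
    With this relabelling the graph of the schedule is equal to the clique, so the identity serves
    as isomorphism.\<close>
  define r where "r = (\<lambda>l. Suc (inv_into {..<length L} ((!) L) l))"
  have "inj_on ((!) L) {..<length L}"
    using L(1) by (simp add: inj_on_nth strict_sorted_iff)
  then have r_nth: "r (L ! t) = Suc t" if "t < length L" for t
    using that by (simp add: r_def)
  have r: "strict_mono_on (lam ` E) r"
  proof (rule strict_mono_onI)
    fix k l assume kl: "k \<in> lam ` E" "l \<in> lam ` E" "k < l"
    then obtain s t where st: "s < length L" "t < length L" "k = L ! s" "l = L ! t"
      using L(2) by (metis in_set_conv_nth)
    then have "s < t"
      using kl(3) L(1) by (metis less_asym linorder_neqE_nat sorted_wrt_iff_nth_less)
    then show "r k < r l" using st r_nth by simp
  qed
  have r_xs: "r (lam (xs ! t)) = Suc t" if "t < length xs" for t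
    using that lam_xs r_nth by (simp add: xs_def)
  have "{(xs ! t, Suc t) |t. t < length xs} = {(e, r (lam e)) |e. e \<in> E}"
    unfolding xs[symmetric] using r_xs by (fastforce simp: in_set_conv_nth)
  then have graph: "mobility_graph vs xs = clique_graph V (r \<circ> lam)"
    using vs(2) by (simp add: mobility_graph_def clique_graph_def E_def)
  have "inj_on (r \<circ> lam) E"
    using inj strict_mono_on_imp_inj_on[OF r] by (rule comp_inj_on)
  then have "temporal_clique V (r \<circ> lam)"
    using assms by (simp add: temporal_clique_def E_def)
  then have "is_temporal_clique (mobility_graph vs xs)"
    using graph by (auto simp: is_temporal_clique_def)
  moreover have "isomorphic (clique_graph V (r \<circ> lam)) (mobility_graph vs xs)"
    unfolding graph isomorphic_def by (rule exI[of _ id]) simp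
  ultimately show "mobility_temporal_clique V lam"
    unfolding mobility_temporal_clique_def using assms r vs(1) sched E_def by blast
qed

end
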